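(* Let $C$ be a binary linear code of length $n$, let $E=\{1,\dots,n\}$ and let $f\in\mathrm{Harm}_d$. Then \[ Z_{C,f}(x,y)=(-1)^{d}\sum_{t=d}^{n-d}B_{t,f}\,(x-y)^{t-d}\,y^{n-t-d}. \]
   Context: $E_t$ denotes the set of $t$-element subsets of $E$. For $f:E_d\to\mathbb{R}$ and $X\subset E$, $\widetilde f(X):=\sum_{Z\in E_d,\,Z\subset X}f(Z)$. $\mathrm{Harm}_d$ is the set of $f:E_d\to\mathbb{R}$ with $\sum_{Z\in E_d,\,Z\supset Y}f(Z)=0$ for every $(d-1)$-subset $Y\subset E$. For $\mathbf u\in\mathbb{F}_2^n$, $\mathrm{supp}(\mathbf u)=\{i:u_i\ne0\}$, $\mathrm{wt}(\mathbf u)=|\mathrm{supp}(\mathbf u)|$, $\widetilde f(\mathbf u):=\widetilde f(\mathrm{supp}(\mathbf u))$. The harmonic weight enumerator is $W_{C,f}(x,y)=\sum_{\mathbf u\in C}\widetilde f(\mathbf u)x^{n-\mathrm{wt}(\mathbf u)}y^{\mathrm{wt}(\mathbf u)}=\sum_{i=0}^n A_{i,f}x^{n-i}y^i$ with $A_{i,f}:=\sum_{\mathbf u\in C,\,\mathrm{wt}(\mathbf u)=i}\widetilde f(\mathbf u)$, and $Z_{C,f}(x,y):=\sum_{i=0}^nA_{i,f}x^{n-i-d}y^{i-d}$, so that $W_{C,f}=(xy)^dZ_{C,f}$ (it is a polynomial since $A_{i,f}=0$ for $i<d$ and $i>n-d$). For $J\subset E$: $C(J):=\{\mathbf c\in C: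 c_j=0\ \forall j\in J\}$, $\ell(J):=\dim C(J)$, $B_J:=2^{\ell(J)}-1$, and $B_{t,f}:=\sum_{J\in E_t}\widetilde f(J)B_J$.
   Formalization: The degree d is assumed to be at least 1; for d = 0 the identity fails (for n = 1, C = {0}, f(∅) = 1 the left side is x and the right side is 0). *)

theory Defs
  imports "HOL-Analysis.Cartesian_Space" "HOL-Library.Z2" "HOL-Library.Poly_Mapping"
    "HOL-Library.Product_Plus"
begin

text \<open>
  The coordinate set \<open>E\<close> is the finite index type \<open>'n\<close>, so the length is \<open>n = CARD('n)\<close> and
  \<open>\<bbbF>\<^sub>2\<^sup>n\<close> is \<open>bit ^ 'n\<close>.
\<close>

definition subsets_of_size :: "nat \<Rightarrow> 'n::finite set set" where
  "subsets_of_size t = {Z. card Z = t}"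

definition f_tilde :: "nat \<Rightarrow> ('n::finite set \<Rightarrow> real) \<Rightarrow> 'n set \<Rightarrow> real" where
  "f_tilde d f X = (\<Sum>Z \<in> {Z \<in> subsets_of_size d. Z \<subseteq> X}. f Z)"

text \<open>
  A function on the \<open>d\<close>-subsets of \<open>E\<close> is represented by a total function on sets; its
  values on sets of other sizes are never used. The condition \<open>card Y + 1 = d\<close> says that \<open>Y\<close> is
  a \<open>(d-1)\<close>-subset without truncated subtraction, so it is vacuous for \<open>d = 0\<close>.
\<close>

definition Harm :: "nat \<Rightarrow> ('n::finite set \<Rightarrow> real) set" where
  "Harm d = {f. \<forall>Y. card Y + 1 = d \<longrightarrow> (\<Sum>Z \<in> {Z \<in> subsets_of_size d. Y \<subseteq> Z}. f Z) = 0}"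

definition supp :: "bit ^ 'n::finite \<Rightarrow> 'n set" where
  "supp u = {i. u $ i \<noteq> 0}"

definition wt :: "bit ^ 'n::finite \<Rightarrow> nat" where
  "wt u = card (supp u)"

definition A_coeff :: "(bit ^ 'n::finite) set \<Rightarrow> nat \<Rightarrow> ('n set \<Rightarrow> real) \<Rightarrow> nat \<Rightarrow> real" where
  "A_coeff C d f i = (\<Sum>u \<in> {u \<in> C. wt u = i}. f_tilde d f (supp u))"

text \<open>
  The exponents \<open>n-i-d\<close> and \<open>i-d\<close> in \<open>Z\<^sub>C\<^sub>,\<^sub>f\<close> may be negative (the coefficients of those
  terms vanish, but only by a theorem), so the enumerators live in the ring
  \<open>\<real>[x, y, 1/x, 1/y]\<close> of formal Laurent polynomials, which contains \<open>\<real>[x, y]\<close>: finitely supported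
  functions on exponent pairs, multiplied by convolution.
\<close>

type_synonym laurent2 = "(int \<times> int) \<Rightarrow>\<^sub>0 real"

abbreviation laurent_monom :: "real \<Rightarrow> int \<Rightarrow> int \<Rightarrow> laurent2" where
  "laurent_monom c a b \<equiv> Poly_Mapping.single (a, b) c"

abbreviation laurent_const :: "real \<Rightarrow> laurent2" where
  "laurent_const c \<equiv> laurent_monom c 0 0"

definition var_x :: laurent2 where
  "var_x = laurent_monom 1 1 0"

definition var_y :: laurent2 where
  "var_y = laurent_monom 1 0 1"

definition W_enum :: "(bit ^ 'n::finite) set \<Rightarrow> nat \<Rightarrow> ('n set \<Rightarrow> real) \<Rightarrow> laurent2" where
  "W_enum C d f = (\<Sum>u\<in>C. laurent_const (f_tilde d f (supp u)) *
     var_x ^ (CARD('n) - wt u) * var_y ^ wt u)"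

definition Z_enum :: "(bit ^ 'n::finite) set \<Rightarrow> nat \<Rightarrow> ('n set \<Rightarrow> real) \<Rightarrow> laurent2" where
  "Z_enum C d f = (\<Sum>i = 0..CARD('n).
     laurent_monom (A_coeff C d f i) (int CARD('n) - int i - int d) (int i - int d))"

definition shortened :: "(bit ^ 'n::finite) set \<Rightarrow> 'n set \<Rightarrow> (bit ^ 'n) set" where
  "shortened C J = {c \<in> C. \<forall>j\<in>J. c $ j = 0}"

definition ell :: "(bit ^ 'n::finite) set \<Rightarrow> 'n set \<Rightarrow> nat" where
  "ell C J = vec.dim (shortened C J)"

definition B_set :: "(bit ^ 'n::finite) set \<Rightarrow> 'n set \<Rightarrow> real" where
  "B_set C J = 2 ^ ell C J - 1"

definition B_coeff :: "(bit ^ 'n::finite) set \<Rightarrow> nat \<Rightarrow> ('n set \<Rightarrow> real) \<Rightarrow> nat \<Rightarrow> real" where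
  "B_coeff C d f t = (\<Sum>J \<in> subsets_of_size t. f_tilde d f J * B_set C J)"

lemma var_x_power: "var_x ^ k = laurent_monom 1 (int k) 0"
  by (induction k) (simp_all add: var_x_def mult_single flip: zero_prod_def)

lemma var_y_power: "var_y ^ k = laurent_monom 1 0 (int k)"
  by (induction k) (simp_all add: var_y_def mult_single flip: zero_prod_def)

instance bit :: finite
proof
  show "finite (UNIV :: bit set)"
    by (rule finite_subset[of _ "{0, 1}"]) (auto intro: bit.exhaust)
qed

lemma finite_code: "finite (C :: (bit ^ 'n::finite) set)"
  by simp

lemma W_enum_eq:
  fixes C :: "(bit ^ 'n::finite) set"
  shows "W_enum C d f = (var_x * var_y) ^ d * Z_enum C d f"
proof -
  let ?n = "CARD('n)"
  have wt_le: "wt u \<le> ?n" for u :: "bit ^ 'n"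
    by (simp add: wt_def card_mono)
  have "W_enum C d f =
      (\<Sum>u\<in>C. laurent_monom (f_tilde d f (supp u)) (int (?n - wt u)) (int (wt u)))"
    by (simp add: W_enum_def var_x_power var_y_power mult_single)
  also have "\<dots> = (\<Sum>i = 0..?n. \<Sum>u \<in> {u \<in> C. wt u = i}.
      laurent_monom (f_tilde d f (supp u)) (int (?n - wt u)) (int (wt u)))"
    by (rule sum.group[symmetric]) (auto simp: finite_code wt_le)
  also have "\<dots> = (\<Sum>i = 0..?n. laurent_monom (A_coeff C d f i) (int ?n - int i) (int i))"
  proof (rule sum.cong[OF refl])
    fix i assume i: "i \<in> {0..?n}"
    have single_sum: "Poly_Mapping.single k (\<Sum>u\<in>S. g u) = (\<Sum>u\<in>S. Poly_Mapping.single k (g u))"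
      for k :: "int \<times> int" and S :: "(bit ^ 'n) set" and g :: "bit ^ 'n \<Rightarrow> real"
      by (induction S rule: infinite_finite_induct) (simp_all add: single_add)
    show "(\<Sum>u \<in> {u \<in> C. wt u = i}.
        laurent_monom (f_tilde d f (supp u)) (int (?n - wt u)) (int (wt u))) =
        laurent_monom (A_coeff C d f i) (int ?n - int i) (int i)"
      using i by (simp add: A_coeff_def single_sum of_nat_diff)
  qed
  also have "\<dots> = (var_x * var_y) ^ d * Z_enum C d f"
    by (simp add: Z_enum_def power_mult_distrib var_x_power var_y_power mult_single
        sum_distrib_left)
  finally show ?thesis .
qed

end

theory Submission
  imports Defs
begin

text \<open>
  A harmonic \<open>f\<close> sums to zero over the supersets of any set with fewer than \<open>d\<close> elements, so
  inclusion--exclusion over \<open>Y \<subseteq> X\<close> leaves only the terms with \<open>card Y = d\<close> and gives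
  \<open>f_tilde d f (- X) = (- 1) ^ d * f_tilde d f X\<close>. Since \<open>B_set C J + 1\<close> counts the codewords whose
  support avoids \<open>J\<close>, double counting turns this into
  \<open>B_coeff C d f t = (- 1) ^ d * (\<Sum>i. A_coeff C d f i * (n - d - i choose (t - d)))\<close>, and the
  claim is the binomial theorem for \<open>x = (x - y) + y\<close>.
\<close>

section \<open>Harmonic functions and complements\<close>

lemma f_tilde_altdef: "f_tilde d f X = (\<Sum>Z | card Z = d \<and> Z \<subseteq> X. f Z)"
  by (simp add: f_tilde_def subsets_of_size_def)

lemma f_tilde_eq_0_if_card_less:
  assumes "card X < d"
  shows "f_tilde d f X = 0"
proof -
  have "{Z. card Z = d \<and> Z \<subseteq> X} = {}"
    using assms by (auto dest!: card_mono[rotated])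
  then show ?thesis
    unfolding f_tilde_altdef by (simp only: sum.empty)
qed

text \<open>Induction on the deficit of \<open>Y\<close>, with \<open>Harm\<close> as base. Adding
  up the vanishing sums for all \<open>insert e Y\<close> counts each \<open>Z\<close> exactly
  \<open>card (Z - Y)\<close> times, a nonzero constant that cancels.\<close>

lemma Harm_sum_supersets_eq_0:
  fixes f :: "'n::finite set \<Rightarrow> real"
  assumes "f \<in> Harm d" "card Y + Suc k = d"
  shows "(\<Sum>Z | card Z = d \<and> Y \<subseteq> Z. f Z) = 0"
  using assms(2)
proof (induction k arbitrary: Y)
  case 0
  with assms(1) show ?case
    by (simp add: Harm_def subsets_of_size_def)
next
  case (Suc k)
  have "0 = (\<Sum>e\<in>-Y. \<Sum>Z | card Z = d \<and> insert e Y \<subseteq> Z. f Z)"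
    using Suc by (intro sum.neutral[symmetric] ballI Suc.IH) simp
  also have "\<dots> = (\<Sum>e\<in>-Y. \<Sum>Z\<in>{Z \<in> {Z. card Z = d \<and> Y \<subseteq> Z}. e \<in> Z}. f Z)"
    by (intro sum.cong) auto
  also have "\<dots> = (\<Sum>Z | card Z = d \<and> Y \<subseteq> Z. \<Sum>e\<in>{e \<in> -Y. e \<in> Z}. f Z)"
    by (rule sum.swap_restrict) auto
  also have "\<dots> = (\<Sum>Z | card Z = d \<and> Y \<subseteq> Z. real (Suc (Suc k)) * f Z)"
  proof (intro sum.cong refl)
    fix Z assume "Z \<in> {Z. card Z = d \<and> Y \<subseteq> Z}"
    moreover have "{e \<in> -Y. e \<in> Z} = Z - Y"
      by auto
    ultimately have "card {e \<in> -Y. e \<in> Z} = Suc (Suc k)"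
      using Suc.prems by (auto simp: card_Diff_subset)
    then show "(\<Sum>e\<in>{e \<in> -Y. e \<in> Z}. f Z) = real (Suc (Suc k)) * f Z"
      by simp
  qed
  also have "\<dots> = real (Suc (Suc k)) * (\<Sum>Z | card Z = d \<and> Y \<subseteq> Z. f Z)"
    by (simp add: sum_distrib_left)
  finally show ?case
    by simp
qed

text \<open>Expand the product of \<open>- 1 + 1\<close> over \<open>A\<close>. This turns emptiness
  into an alternating sum.\<close>

lemma sum_neg_one_power_card_subsets:
  assumes "finite A"
  shows "(\<Sum>Y\<in>Pow A. (- 1) ^ card Y) = (if A = {} then 1 else 0 :: real)"
proof -
  have "(\<Sum>Y\<in>Pow A. (- 1) ^ card Y) = (\<Sum>Y\<in>Pow A. \<Prod>a\<in>Y. - 1 :: real)"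
    by simp
  also have "\<dots> = (\<Prod>a\<in>A. - 1 + 1)"
    using assms by (subst prod_add) (simp_all)
  also have "\<dots> = (if A = {} then 1 else 0)"
    using assms by (simp add: card_gt_0_iff)
  finally show ?thesis .
qed

lemma Harm_f_tilde_compl:
  fixes f :: "'n::finite set \<Rightarrow> real"
  assumes "f \<in> Harm d"
  shows "f_tilde d f (- X) = (- 1) ^ d * f_tilde d f X"
proof -
  have "f_tilde d f (- X) = (\<Sum>Z | card Z = d. if Z \<inter> X = {} then f Z else 0)"
    unfolding f_tilde_altdef
    by (subst sum.inter_filter[symmetric]) (auto intro!: sum.cong)
  \<comment> \<open>The condition \<open>Z \<inter> X = {}\<close> becomes an alternating sum over
    the subsets of \<open>Z \<inter> X\<close>.\<close>
  also have "\<dots> = (\<Sum>Z | card Z = d. \<Sum>Y\<in>{Y \<in> Pow X. Y \<subseteq> Z}. (- 1) ^ card Y * f Z)"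
  proof (intro sum.cong refl)
    fix Z
    have "{Y \<in> Pow X. Y \<subseteq> Z} = Pow (Z \<inter> X)"
      by auto
    then show "(if Z \<inter> X = {} then f Z else 0) =
        (\<Sum>Y\<in>{Y \<in> Pow X. Y \<subseteq> Z}. (- 1) ^ card Y * f Z)"
      by (simp only: sum_neg_one_power_card_subsets[OF finite] flip: sum_distrib_right) simp
  qed
  also have "\<dots> = (\<Sum>Y\<in>Pow X. \<Sum>Z\<in>{Z \<in> {Z. card Z = d}. Y \<subseteq> Z}. (- 1) ^ card Y * f Z)"
    by (rule sum.swap_restrict) auto
  \<comment> \<open>Smaller \<open>Y\<close> vanish by harmonicity, larger \<open>Y\<close> lie in
    no \<open>d\<close>-set, and for \<open>card Y = d\<close> only \<open>Z = Y\<close>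
    remains.\<close>
  also have "\<dots> = (\<Sum>Y\<in>Pow X. if card Y = d then (- 1) ^ d * f Y else 0)"
  proof (intro sum.cong refl)
    fix Y :: "'n set"
    consider "card Y < d" | "card Y = d" | "card Y > d"
      by linarith
    then show "(\<Sum>Z\<in>{Z \<in> {Z. card Z = d}. Y \<subseteq> Z}. (- 1) ^ card Y * f Z) =
        (if card Y = d then (- 1) ^ d * f Y else 0)"
    proof cases
      case 1
      then obtain k where "card Y + Suc k = d"
        by (metis add_Suc_right less_imp_Suc_add)
      then show ?thesis
        using 1 Harm_sum_supersets_eq_0[OF assms] by (simp flip: sum_distrib_left)
    next
      case 2
      then have "{Z. card Z = d \<and> Y \<subseteq> Z} = {Y}"
        by (auto dest: card_subset_eq[OF finite])
      then show ?thesis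
        using 2 by simp
    next
      case 3
      then have "{Z. card Z = d \<and> Y \<subseteq> Z} = {}"
        by (auto dest!: card_mono[rotated])
      then show ?thesis
        using 3 by (simp only: mem_Collect_eq sum.empty) simp
    qed
  qed
  also have "\<dots> = (- 1) ^ d * f_tilde d f X"
    unfolding f_tilde_altdef sum_distrib_left
    by (subst sum.inter_filter[symmetric]) (auto intro!: sum.cong)
  finally show ?thesis .
qed

section \<open>Double counting of nested subsets\<close>

text \<open>Removing \<open>Z\<close> is a bijection onto subsets of \<open>S - Z\<close>. If
  \<open>card Z > t\<close>, no \<open>J\<close> exists but the truncated binomial would be
  1.\<close>

lemma card_subsets_between:
  assumes "finite S" "Z \<subseteq> S" "card Z \<le> t"
  shows "card {J. card J = t \<and> J \<subseteq> S \<and> Z \<subseteq> J} = (card S - card Z) choose (t - card Z)"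
proof -
  have fin: "finite A" if "A \<subseteq> S" for A
    using that assms(1) finite_subset by blast
  have "bij_betw (\<lambda>K. Z \<union> K) {K. K \<subseteq> S - Z \<and> card K = t - card Z}
      {J. card J = t \<and> J \<subseteq> S \<and> Z \<subseteq> J}"
  proof (rule bij_betwI[where g = "\<lambda>J. J - Z"])
    show "(\<lambda>K. Z \<union> K) \<in> {K. K \<subseteq> S - Z \<and> card K = t - card Z} \<rightarrow>
        {J. card J = t \<and> J \<subseteq> S \<and> Z \<subseteq> J}"
    proof
      fix K assume K: "K \<in> {K. K \<subseteq> S - Z \<and> card K = t - card Z}"
      then have "card (Z \<union> K) = card Z + card K"
        using assms by (intro card_Un_disjoint fin) auto
      with K show "Z \<union> K \<in> {J. card J = t \<and> J \<subseteq> S \<and> Z \<subseteq> J}"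
        using assms by auto
    qed
    show "(\<lambda>J. J - Z) \<in> {J. card J = t \<and> J \<subseteq> S \<and> Z \<subseteq> J} \<rightarrow>
        {K. K \<subseteq> S - Z \<and> card K = t - card Z}"
      using fin[OF assms(2)] by (auto simp: card_Diff_subset)
  qed auto
  then have "card {J. card J = t \<and> J \<subseteq> S \<and> Z \<subseteq> J} =
      card {K. K \<subseteq> S - Z \<and> card K = t - card Z}"
    by (rule bij_betw_same_card[symmetric])
  also have "\<dots> = card (S - Z) choose (t - card Z)"
    using assms(1) by (intro n_subsets) simp
  also have "card (S - Z) = card S - card Z"
    using assms by (intro card_Diff_subset fin)
  finally show ?thesis .
qed

text \<open>Every \<open>d\<close>-set \<open>Z \<subseteq> S\<close> lies in equally many
  \<open>J\<close>. If \<open>card S < d\<close>, both sides are 0.\<close>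

lemma sum_f_tilde_subsets:
  assumes "d \<le> t"
  shows "(\<Sum>J | card J = t \<and> J \<subseteq> S. f_tilde d f J) =
    f_tilde d f S * real ((card S - d) choose (t - d))"
proof -
  have "(\<Sum>J | card J = t \<and> J \<subseteq> S. f_tilde d f J) =
      (\<Sum>J | card J = t \<and> J \<subseteq> S. \<Sum>Z\<in>{Z \<in> {Z. card Z = d \<and> Z \<subseteq> S}. Z \<subseteq> J}. f Z)"
    unfolding f_tilde_altdef by (intro sum.cong) auto
  also have "\<dots> = (\<Sum>Z | card Z = d \<and> Z \<subseteq> S.
      \<Sum>J\<in>{J \<in> {J. card J = t \<and> J \<subseteq> S}. Z \<subseteq> J}. f Z)"
    by (rule sum.swap_restrict) auto
  also have "\<dots> = (\<Sum>Z | card Z = d \<and> Z \<subseteq> S. f Z * real ((card S - d) choose (t - d)))"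
  proof (intro sum.cong refl)
    fix Z assume "Z \<in> {Z. card Z = d \<and> Z \<subseteq> S}"
    then show "(\<Sum>J\<in>{J \<in> {J. card J = t \<and> J \<subseteq> S}. Z \<subseteq> J}. f Z) =
        f Z * real ((card S - d) choose (t - d))"
      using card_subsets_between[of S Z t] assms by (simp add: conj_assoc)
  qed
  also have "\<dots> = f_tilde d f S * real ((card S - d) choose (t - d))"
    by (simp add: f_tilde_altdef sum_distrib_right)
  finally show ?thesis .
qed

section \<open>Codes and their shortened subcodes\<close>

text \<open>Over two elements a linear combination of a basis is a subset sum, so \<open>S\<close>
  corresponds to the power set of a basis.\<close>

lemma card_subspace_bit_vec:
  fixes S :: "(bit ^ 'n::finite) set"
  assumes "vec.subspace S"
  shows "card S = 2 ^ vec.dim S"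
proof -
  obtain B where B: "B \<subseteq> S" "vec.independent B" "S \<subseteq> vec.span B" "card B = vec.dim S"
    using vec.basis_exists by blast
  have span: "vec.span B = S"
    using B assms vec.span_minimal by blast
  have fin: "finite B"
    by simp
  define g where "g T = (\<Sum>v\<in>B. (if v \<in> T then 1 else 0) *s v)" for T
  have "bij_betw g (Pow B) S"
  proof (rule bij_betw_imageI)
    show "inj_on g (Pow B)"
    proof (rule inj_onI)
      fix T T' assume T: "T \<in> Pow B" "T' \<in> Pow B" "g T = g T'"
      then have "(\<Sum>v\<in>B. ((if v \<in> T then 1 else 0) - (if v \<in> T' then 1 else 0)) *s v) = 0"
        by (simp only: g_def vec.scale_left_diff_distrib sum_subtractf diff_self)
      \<comment> \<open>Independence kills the coefficient differences, which are nonzero exactly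
        where \<open>T\<close> and \<open>T'\<close> disagree.\<close>
      then have "v \<in> T \<longleftrightarrow> v \<in> T'" if "v \<in> B" for v
        using vec.independentD[OF B(2) fin subset_refl, where
            u = "\<lambda>v. (if v \<in> T then 1 else 0) - (if v \<in> T' then 1 else 0)"] that
        by (force split: if_splits)
      then show "T = T'"
        using T(1,2) by (force split: if_splits)
    qed
    show "g ` Pow B = S"
    proof
      show "g ` Pow B \<subseteq> S"
        using B(1) assms by (auto simp: g_def intro!: vec.subspace_sum vec.subspace_scale)
      show "S \<subseteq> g ` Pow B"
      proof
        fix x assume "x \<in> S"
        then obtain u where "x = (\<Sum>v\<in>B. u v *s v)"
          using vec.span_finite[OF fin] span by auto
        then have "x = g {v \<in> B. u v \<noteq> 0}"
          by (auto simp: g_def intro!: sum.cong)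
        then show "x \<in> g ` Pow B"
          by auto
      qed
    qed
  qed
  then show ?thesis
    using B(4) by (metis bij_betw_same_card card_Pow fin)
qed

lemma subspace_shortened:
  "vec.subspace C \<Longrightarrow> vec.subspace (shortened C J)"
  by (auto simp: vec.subspace_def shortened_def)

text \<open>The condition \<open>J \<subseteq> - supp u\<close> says that \<open>u\<close> vanishes
  on \<open>J\<close>; in this form the sums over \<open>J\<close> and \<open>u\<close> can be
  exchanged.\<close>

lemma B_set_eq_card:
  assumes "vec.subspace C"
  shows "B_set C J = real (card {u \<in> C. J \<subseteq> - supp u}) - 1"
proof -
  have "shortened C J = {u \<in> C. J \<subseteq> - supp u}"
    by (auto simp: shortened_def supp_def)
  then show ?thesis
    using card_subspace_bit_vec[OF subspace_shortened[OF assms, of J]]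
    by (simp add: B_set_def ell_def)
qed

section \<open>The coefficients of both enumerators\<close>

lemma card_Compl_UNIV: "card (- X) = CARD('n) - card X" for X :: "'n::finite set"
  by (simp add: Compl_eq_Diff_UNIV card_Diff_subset)

text \<open>A light support contains no \<open>d\<close>-set; a heavy one has a complement
  containing none, and \<open>Harm_f_tilde_compl\<close> carries the vanishing over.\<close>

lemma A_coeff_eq_0:
  fixes f :: "'n::finite set \<Rightarrow> real"
  assumes "f \<in> Harm d" "i < d \<or> CARD('n) < i + d"
  shows "A_coeff C d f i = 0"
  unfolding A_coeff_def
proof (intro sum.neutral ballI)
  fix u assume u: "u \<in> {u \<in> C. wt u = i}"
  show "f_tilde d f (supp u) = 0"
  proof (cases "i < d")
    case True
    with u show ?thesis
      by (intro f_tilde_eq_0_if_card_less) (simp add: wt_def)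
  next
    case False
    have "card (- supp u) < d"
      using u False assms(2) card_mono[OF finite subset_UNIV, of "supp u"]
      by (auto simp: wt_def card_Compl_UNIV)
    then show ?thesis
      using Harm_f_tilde_compl[OF assms(1), of "supp u"] f_tilde_eq_0_if_card_less by fastforce
  qed
qed

lemma B_coeff_eq:
  fixes C :: "(bit ^ 'n::finite) set"
  assumes "vec.subspace C" "d \<ge> 1" "f \<in> Harm d" "d \<le> t"
  shows "B_coeff C d f t = (- 1) ^ d *
    (\<Sum>i = 0..CARD('n). A_coeff C d f i * real ((CARD('n) - d - i) choose (t - d)))"
proof -
  let ?n = "CARD('n)"
  \<comment> \<open>As \<open>d \<ge> 1\<close>, harmonicity applies to the empty set. Hence the
    \<open>- 1\<close> in \<open>B_set\<close> contributes nothing below.\<close>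
  have "f_tilde d f UNIV = 0"
    using Harm_sum_supersets_eq_0[OF assms(3), of "{}" "d - 1"] assms(2)
    by (simp add: f_tilde_altdef)
  then have total: "(\<Sum>J | card J = t. f_tilde d f J) = 0"
    using sum_f_tilde_subsets[OF assms(4), of f UNIV] by simp
  have "B_coeff C d f t = (\<Sum>J | card J = t. f_tilde d f J * real (card {u \<in> C. J \<subseteq> - supp u}))"
    using total
    by (simp add: B_coeff_def subsets_of_size_def B_set_eq_card[OF assms(1)]
        right_diff_distrib sum_subtractf)
  also have "\<dots> = (\<Sum>J | card J = t. \<Sum>u\<in>{u \<in> C. J \<subseteq> - supp u}. f_tilde d f J)"
    by (simp add: mult.commute)
  also have "\<dots> = (\<Sum>u\<in>C. \<Sum>J\<in>{J \<in> {J. card J = t}. J \<subseteq> - supp u}. f_tilde d f J)"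
    by (rule sum.swap_restrict) auto
  \<comment> \<open>The inner sum yields \<open>f_tilde\<close> at \<open>- supp u\<close>;
    returning to \<open>supp u\<close> produces the sign.\<close>
  also have "\<dots> = (\<Sum>u\<in>C. (- 1) ^ d * (f_tilde d f (supp u) *
      real ((?n - d - wt u) choose (t - d))))"
    by (simp add: sum_f_tilde_subsets[OF assms(4)] Harm_f_tilde_compl[OF assms(3)] card_Compl_UNIV
        wt_def ac_simps)
  also have "\<dots> = (- 1) ^ d * (\<Sum>u\<in>C. f_tilde d f (supp u) *
      real ((?n - d - wt u) choose (t - d)))"
    by (simp add: sum_distrib_left)
  also have "(\<Sum>u\<in>C. f_tilde d f (supp u) * real ((?n - d - wt u) choose (t - d))) =
      (\<Sum>i = 0..?n. \<Sum>u\<in>{u \<in> C. wt u = i}. f_tilde d f (supp u) *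
        real ((?n - d - wt u) choose (t - d)))"
    by (rule sum.group[symmetric]) (auto simp: wt_def card_mono)
  also have "\<dots> = (\<Sum>i = 0..?n. A_coeff C d f i * real ((?n - d - i) choose (t - d)))"
    by (simp add: A_coeff_def sum_distrib_right)
  finally show ?thesis .
qed

section \<open>Laurent constants and the binomial theorem\<close>

lemma laurent_const_add: "laurent_const (a + b) = laurent_const a + laurent_const b"
  by (simp add: single_add)

lemma laurent_const_mult: "laurent_const (a * b) = laurent_const a * laurent_const b"
  by (simp add: mult_single)

lemma laurent_const_1: "laurent_const 1 = 1"
  by (simp flip: zero_prod_def)

lemma laurent_const_sum: "laurent_const (\<Sum>i\<in>S. g i) = (\<Sum>i\<in>S. laurent_const (g i))"
  by (induction S rule: infinite_finite_induct) (simp_all add: laurent_const_add)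

lemma laurent_const_of_nat: "laurent_const (real k) = of_nat k"
  by (induction k) (simp_all add: laurent_const_add laurent_const_1)

lemma laurent_const_neg_one_power: "laurent_const ((- 1) ^ k) = (- 1) ^ k"
  by (induction k) (simp_all add: laurent_const_1 single_uminus)

lemma binomial_shift:
  fixes x y :: "'a::comm_ring_1"
  assumes "d \<le> i" "i + d \<le> n"
  shows "(\<Sum>t = d..n - d. of_nat ((n - d - i) choose (t - d)) * (x - y) ^ (t - d) * y ^ (n - t - d)) =
    x ^ (n - d - i) * y ^ (i - d)"
proof -
  let ?m = "n - d - i"
  have "(\<Sum>t = d..n - d. of_nat (?m choose (t - d)) * (x - y) ^ (t - d) * y ^ (n - t - d)) =
      (\<Sum>t = d..?m + d. of_nat (?m choose (t - d)) * (x - y) ^ (t - d) * y ^ (n - t - d))"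
    \<comment> \<open>Since \<open>d \<le> i\<close>, the range only shrinks; the dropped binomials
      are 0.\<close>
    using assms by (intro sum.mono_neutral_right) (auto simp: binomial_eq_0)
  also have "\<dots> = (\<Sum>s = 0..?m. of_nat (?m choose s) * (x - y) ^ s * y ^ (n - (s + d) - d))"
    using sum.shift_bounds_cl_nat_ivl
      [of "\<lambda>t. of_nat (?m choose (t - d)) * (x - y) ^ (t - d) * y ^ (n - t - d)" 0 d ?m]
    by simp
  also have "\<dots> = (\<Sum>s\<le>?m. of_nat (?m choose s) * (x - y) ^ s * y ^ (?m - s)) * y ^ (i - d)"
    unfolding sum_distrib_right atMost_atLeast0
  proof (intro sum.cong refl)
    fix s assume "s \<in> {0..?m}"
    \<comment> \<open>No subtraction truncates here, so \<open>y ^ (i - d)\<close> factors out of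
      every term.\<close>
    then have "n - (s + d) - d = (?m - s) + (i - d)"
      using assms by auto
    then show "of_nat (?m choose s) * (x - y) ^ s * y ^ (n - (s + d) - d) =
        of_nat (?m choose s) * (x - y) ^ s * y ^ (?m - s) * y ^ (i - d)"
      by (simp only: power_add mult.assoc)
  qed
  also have "(\<Sum>s\<le>?m. of_nat (?m choose s) * (x - y) ^ s * y ^ (?m - s)) = x ^ ?m"
    using binomial_ring[of "x - y" y ?m] by simp
  finally show ?thesis .
qed

theorem theorem3p7:
  fixes C :: "(bit ^ 'n::finite) set" and f :: "'n set \<Rightarrow> real" and d :: nat
  assumes "vec.subspace C"
    and "d \<ge> 1"
    and "f \<in> Harm d"
  shows "Z_enum C d f =
    (-1) ^ d * (\<Sum>t = d..CARD('n) - d.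
      laurent_const (B_coeff C d f t) * (var_x - var_y) ^ (t - d) * var_y ^ (CARD('n) - t - d))"
proof -
  let ?n = "CARD('n)"
  let ?P = "\<lambda>t. (var_x - var_y) ^ (t - d) * var_y ^ (?n - t - d)"
  let ?b = "\<lambda>i t. of_nat ((?n - d - i) choose (t - d)) :: laurent2"
  have "(-1) ^ d * (\<Sum>t = d..?n - d.
      laurent_const (B_coeff C d f t) * (var_x - var_y) ^ (t - d) * var_y ^ (?n - t - d)) =
      (-1) ^ d * (\<Sum>t = d..?n - d. (-1) ^ d * (\<Sum>i = 0..?n. laurent_const (A_coeff C d f i) * (?b i t * ?P t)))"
    by (intro arg_cong[where f = "(*) _"] sum.cong refl)
      (simp add: B_coeff_eq[OF assms] laurent_const_mult laurent_const_neg_one_power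
        laurent_const_sum laurent_const_of_nat sum_distrib_right mult.assoc)
  \<comment> \<open>The outer sign cancels the one from \<open>B_coeff_eq\<close>.\<close>
  also have "\<dots> = (\<Sum>t = d..?n - d. \<Sum>i = 0..?n. laurent_const (A_coeff C d f i) * (?b i t * ?P t))"
    by (simp flip: sum_distrib_left mult.assoc power_mult_distrib)
  also have "\<dots> = (\<Sum>i = 0..?n. laurent_const (A_coeff C d f i) * (\<Sum>t = d..?n - d. ?b i t * ?P t))"
    by (subst sum.swap) (simp only: sum_distrib_left)
  also have "\<dots> = Z_enum C d f"
    unfolding Z_enum_def
  proof (intro sum.cong refl)
    fix i
    show "laurent_const (A_coeff C d f i) * (\<Sum>t = d..?n - d. ?b i t * ?P t) =
        laurent_monom (A_coeff C d f i) (int ?n - int i - int d) (int i - int d)"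
    proof (cases "d \<le> i \<and> i + d \<le> ?n")
      case True
      then have "(\<Sum>t = d..?n - d. ?b i t * ?P t) = var_x ^ (?n - d - i) * var_y ^ (i - d)"
        using binomial_shift[of d i ?n var_x var_y] by (simp add: mult.assoc)
      with True show ?thesis
        by (simp add: var_x_power var_y_power mult_single of_nat_diff algebra_simps)
    next
      \<comment> \<open>Here natural and integer exponents may differ, but the coefficient is
        0.\<close>
      case False
      then show ?thesis
        using A_coeff_eq_0[OF assms(3), of i C] by (simp add: not_le)
    qed
  qed
  finally show ?thesis
    by (rule sym)
qed

end
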